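(* Let $\sigma\in\mathbb{C}$ not be an eigenvalue of $\mathcal{H}$ and let $\phi_1\in X$ be a real-valued function. Then for any two functions $\varphi$ and $\psi$ in the Krylov subspace $\mathrm{K}_m(\mathcal{R}_{\sigma}^{-1},\phi_1)$ the equality $\mathbf{B}(\varphi,J\psi)=0$ holds.
   Context: Let $n,K$ be positive integers, $0<\tau_1<\dots<\tau_K<\infty$, and let $H_0,H_1,H_{-1},\dots,H_K,H_{-K}\in\mathbb{R}^{2n\times 2n}$. Let $J=\begin{bmatrix}0&I_n\\-I_n&0\end{bmatrix}$. Standing assumption: $(JH_0)^{\top}=JH_0$ and $(JH_{-k})^{\top}=JH_k$ for $k=1,\dots,K$. Let $X=C([-\tau_K,\tau_K],\mathbb{C}^{2n})$; for $\psi\in X$, $J\psi$ denotes the function $\theta\mapsto J\psi(\theta)$. The operator $\mathcal{H}:D(\mathcal{H})\subseteq X\to X$ is $\mathcal{H}\varphi=\varphi'$ with $$D(\mathcal{H})=\Big\{\varphi\in X:\varphi'\in X,\ \varphi'(0)=H_0\varphi(0)+\sum_{k=1}^K\big(H_{-k}\varphi(-\tau_k)+H_k\varphi(\tau_k)\big)\Big\}.$$ For $\sigma\in\mathbb{C}$, let $\mathcal{R}_{\sigma}=(\mathcal{H}-\sigma\mathcal{I}_X)(\mathcal{H}+\sigma\mathcal{I}_X)$, i.e. $\mathcal{R}_{\sigma}\varphi=\varphi''-\sigma^2\varphi$ with domain $D(\mathcal{R}_{\sigma})$ consisting of all $\varphi\in X$ with $\varphi',\varphi''\in X$ satisfying $$\varphi'(0)=H_0\varphi(0)+\sum_{k=1}^K\big(H_{-k}\varphi(-\tau_k)+H_k\varphi(\tau_k)\big),\qquad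 \varphi''(0)=H_0\varphi'(0)+\sum_{k=1}^K\big(H_{-k}\varphi'(-\tau_k)+H_k\varphi'(\tau_k)\big).$$ If $\sigma$ is not an eigenvalue of $\mathcal{H}$, then $\mathcal{R}_{\sigma}:D(\mathcal{R}_\sigma)\to X$ is invertible, with inverse $\mathcal{R}_{\sigma}^{-1}:X\to D(\mathcal{R}_{\sigma})\subseteq X$. For a positive integer $m$, the Krylov subspace is $$\mathrm{K}_m(\mathcal{R}_{\sigma}^{-1},\phi_1)=\mathrm{span}\{\phi_1,\mathcal{R}_{\sigma}^{-1}\phi_1,\mathcal{R}_{\sigma}^{-2}\phi_1,\dots,\mathcal{R}_{\sigma}^{-(m-1)}\phi_1\}\subseteq X.$$ The bilinear form $\mathbf{B}(\cdot,\cdot):X\times X\to\mathbb{C}$ is $$\mathbf{B}(\varphi,\psi)=\psi(0)^{\top}\varphi(0)+\sum_{k=1}^K\left(\int_0^{\tau_k}\psi(\theta)^{\top}H_{-k}\varphi(\theta-\tau_k)\,d\theta-\int_0^{\tau_k}\psi(\theta-\tau_k)^{\top}H_k\varphi(\theta)\,d\theta\right).$$ *)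

theory Defs
  imports "HOL-Analysis.Analysis" "HOL-Library.Function_Algebras"
begin

text \<open>
  Vectors of length \<open>2n\<close> are indexed by the sum type \<^typ>\<open>'n + 'n\<close>: the left summand is the first
  block of \<open>n\<close> coordinates and the right summand the second one.  The delays are
  \<open>\<tau> 1, \<dots>, \<tau> K\<close>, and the matrix family is indexed by integers, so that \<open>H (- int k)\<close> is the matrix
  multiplying the value at \<open>- \<tau> k\<close>; only indices between \<open>- int K\<close> and \<open>int K\<close> are used.
\<close>

definition sympJ :: "real^('n::finite + 'n)^('n + 'n)" where
  "sympJ = (\<chi> i j. case i of
       Inl a \<Rightarrow> (case j of Inl b \<Rightarrow> 0 | Inr b \<Rightarrow> (mat 1 :: real^'n^'n) $ a $ b)
     | Inr a \<Rightarrow> (case j of Inl b \<Rightarrow> - ((mat 1 :: real^'n^'n) $ a $ b) | Inr b \<Rightarrow> 0))"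

abbreviation cmat :: "real^'m^'l \<Rightarrow> complex^'m^'l" where
  "cmat \<equiv> map_matrix complex_of_real"

text \<open>
  \<open>Xspace T\<close> represents \<open>C([-T, T], \<complex>\<^sup>m)\<close>.  A continuous function on \<open>[-T, T]\<close> is represented by
  its extension by zero to the whole line, so that equality of functions on the interval is equality
  in HOL and the pointwise vector space operations of functions can be used.
\<close>

definition Xspace :: "real \<Rightarrow> (real \<Rightarrow> complex^'m) set" where
  "Xspace T = {\<phi>. continuous_on {-T..T} \<phi> \<and> (\<forall>\<theta>. \<theta> \<notin> {-T..T} \<longrightarrow> \<phi> \<theta> = 0)}"

definition cscale :: "complex \<Rightarrow> (real \<Rightarrow> complex^'m) \<Rightarrow> real \<Rightarrow> complex^'m" where
  "cscale c \<phi> = (\<lambda>\<theta>. c *s \<phi> \<theta>)"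

lemma vector_space_cscale: "vector_space cscale"
  by unfold_locales
    (auto simp: cscale_def fun_eq_iff vector_add_ldistrib vector_sadd_rdistrib vector_smult_assoc)

text \<open>The derivative on \<open>[-T, T]\<close> (one-sided at the end points), again extended by zero.\<close>

definition deriv_X :: "real \<Rightarrow> (real \<Rightarrow> complex^'m) \<Rightarrow> real \<Rightarrow> complex^'m" where
  "deriv_X T \<phi> = (\<lambda>\<theta>. if \<theta> \<in> {-T..T} then vector_derivative \<phi> (at \<theta> within {-T..T}) else 0)"

definition C1_X :: "real \<Rightarrow> (real \<Rightarrow> complex^'m) set" where
  "C1_X T = {\<phi> \<in> Xspace T. (\<forall>\<theta>\<in>{-T..T}. \<phi> differentiable (at \<theta> within {-T..T})) \<and> deriv_X T \<phi> \<in> Xspace T}"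

definition delay_rhs ::
  "nat \<Rightarrow> (nat \<Rightarrow> real) \<Rightarrow> (int \<Rightarrow> real^'m^'m) \<Rightarrow> (real \<Rightarrow> complex^'m) \<Rightarrow> complex^'m" where
  "delay_rhs K \<tau> H \<phi> = cmat (H 0) *v \<phi> 0
     + (\<Sum>k=1..K. cmat (H (- int k)) *v \<phi> (- \<tau> k) + cmat (H (int k)) *v \<phi> (\<tau> k))"

definition Hop_dom ::
  "nat \<Rightarrow> (nat \<Rightarrow> real) \<Rightarrow> (int \<Rightarrow> real^'m^'m) \<Rightarrow> (real \<Rightarrow> complex^'m) set" where
  "Hop_dom K \<tau> H = {\<phi> \<in> C1_X (\<tau> K). deriv_X (\<tau> K) \<phi> 0 = delay_rhs K \<tau> H \<phi>}"

definition Hop :: "nat \<Rightarrow> (nat \<Rightarrow> real) \<Rightarrow> (real \<Rightarrow> complex^'m) \<Rightarrow> real \<Rightarrow> complex^'m" where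
  "Hop K \<tau> \<phi> = deriv_X (\<tau> K) \<phi>"

definition Hop_eigenvalue ::
  "nat \<Rightarrow> (nat \<Rightarrow> real) \<Rightarrow> (int \<Rightarrow> real^'m^'m) \<Rightarrow> complex \<Rightarrow> bool" where
  "Hop_eigenvalue K \<tau> H \<sigma> \<longleftrightarrow> (\<exists>\<phi>\<in>Hop_dom K \<tau> H. \<phi> \<noteq> 0 \<and> Hop K \<tau> \<phi> = cscale \<sigma> \<phi>)"

definition Rop_dom ::
  "nat \<Rightarrow> (nat \<Rightarrow> real) \<Rightarrow> (int \<Rightarrow> real^'m^'m) \<Rightarrow> (real \<Rightarrow> complex^'m) set" where
  "Rop_dom K \<tau> H = {\<phi> \<in> C1_X (\<tau> K). deriv_X (\<tau> K) \<phi> \<in> C1_X (\<tau> K) \<and>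
     deriv_X (\<tau> K) \<phi> 0 = delay_rhs K \<tau> H \<phi> \<and>
     deriv_X (\<tau> K) (deriv_X (\<tau> K) \<phi>) 0 = delay_rhs K \<tau> H (deriv_X (\<tau> K) \<phi>)}"

definition Rop ::
  "nat \<Rightarrow> (nat \<Rightarrow> real) \<Rightarrow> complex \<Rightarrow> (real \<Rightarrow> complex^'m) \<Rightarrow> real \<Rightarrow> complex^'m" where
  "Rop K \<tau> \<sigma> \<phi> = deriv_X (\<tau> K) (deriv_X (\<tau> K) \<phi>) - cscale (\<sigma>\<^sup>2) \<phi>"

text \<open>
  The inverse of \<open>Rop K \<tau> \<sigma>\<close> as a map from \<open>Xspace (\<tau> K)\<close> to \<open>Rop_dom K \<tau> H\<close>.  It is meaningful when
  \<open>Rop K \<tau> \<sigma>\<close> is a bijection between these sets; this is not assumed anywhere, since it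
  follows from \<open>\<sigma>\<close> not being an eigenvalue.
\<close>

definition Rop_inv ::
  "nat \<Rightarrow> (nat \<Rightarrow> real) \<Rightarrow> (int \<Rightarrow> real^'m^'m) \<Rightarrow> complex \<Rightarrow> (real \<Rightarrow> complex^'m) \<Rightarrow> real \<Rightarrow> complex^'m" where
  "Rop_inv K \<tau> H \<sigma> = inv_into (Rop_dom K \<tau> H) (Rop K \<tau> \<sigma>)"

definition krylov ::
  "nat \<Rightarrow> ((real \<Rightarrow> complex^'m) \<Rightarrow> real \<Rightarrow> complex^'m) \<Rightarrow> (real \<Rightarrow> complex^'m) \<Rightarrow> (real \<Rightarrow> complex^'m) set" where
  "krylov m A \<phi> = module.span cscale ((\<lambda>j. (A ^^ j) \<phi>) ` {..<m})"

text \<open>\<^const>\<open>scalar_product\<close> is the bilinear product \<open>x\<^sup>T y\<close>, without conjugation.\<close>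

definition Bform ::
  "nat \<Rightarrow> (nat \<Rightarrow> real) \<Rightarrow> (int \<Rightarrow> real^'m^'m) \<Rightarrow> (real \<Rightarrow> complex^'m) \<Rightarrow> (real \<Rightarrow> complex^'m) \<Rightarrow> complex" where
  "Bform K \<tau> H \<phi> \<psi> = scalar_product (\<psi> 0) (\<phi> 0)
     + (\<Sum>k=1..K.
          integral {0..\<tau> k} (\<lambda>\<theta>. scalar_product (\<psi> \<theta>) (cmat (H (- int k)) *v \<phi> (\<theta> - \<tau> k)))
        - integral {0..\<tau> k} (\<lambda>\<theta>. scalar_product (\<psi> (\<theta> - \<tau> k)) (cmat (H (int k)) *v \<phi> \<theta>)))"

lemma deriv_X_combination:
  fixes \<phi> :: "real \<Rightarrow> complex^'m"
  assumes T: "T > 0" and d: "\<And>\<theta>. \<theta> \<in> {-T..T} \<Longrightarrow> \<phi> differentiable (at \<theta> within {-T..T})"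
    and e: "\<And>\<theta>. \<theta> \<in> {-T..T} \<Longrightarrow> \<psi> differentiable (at \<theta> within {-T..T})"
  shows "deriv_X T (\<phi> + cscale c \<psi>) = deriv_X T \<phi> + cscale c (deriv_X T \<psi>)"
    and "\<And>\<theta>. \<theta> \<in> {-T..T} \<Longrightarrow> (\<phi> + cscale c \<psi>) differentiable (at \<theta> within {-T..T})"
proof -
  have bl: "bounded_linear (\<lambda>v::complex^'m. c *s v)"
    by (intro linear_conv_bounded_linear[THEN iffD1] linearI)
      (auto simp: vec_eq_iff algebra_simps scaleR_conv_of_real)
  have *: "((\<phi> + cscale c \<psi>) has_vector_derivative deriv_X T \<phi> \<theta> + c *s deriv_X T \<psi> \<theta>) (at \<theta> within {-T..T})"
    if "\<theta> \<in> {-T..T}" for \<theta>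
  proof -
    have "((\<lambda>x. \<phi> x + c *s \<psi> x) has_vector_derivative deriv_X T \<phi> \<theta> + c *s deriv_X T \<psi> \<theta>) (at \<theta> within {-T..T})"
      using that d[OF that] e[OF that]
      by (intro has_vector_derivative_add bounded_linear.has_vector_derivative[OF bl])
        (auto simp: deriv_X_def vector_derivative_works)
    then show ?thesis by (simp add: plus_fun_def cscale_def)
  qed
  show "(\<phi> + cscale c \<psi>) differentiable (at \<theta> within {-T..T})" if "\<theta> \<in> {-T..T}" for \<theta>
    using *[OF that] by (rule differentiableI_vector)
  show "deriv_X T (\<phi> + cscale c \<psi>) = deriv_X T \<phi> + cscale c (deriv_X T \<psi>)"
  proof
    fix \<theta> show "deriv_X T (\<phi> + cscale c \<psi>) \<theta> = (deriv_X T \<phi> + cscale c (deriv_X T \<psi>)) \<theta>"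
    proof (cases "\<theta> \<in> {-T..T}")
      case True
      have "vector_derivative (\<phi> + cscale c \<psi>) (at \<theta> within cbox (-T) T) = deriv_X T \<phi> \<theta> + c *s deriv_X T \<psi> \<theta>"
        using *[OF True] True T by (intro vector_derivative_within_cbox) auto
      with True show ?thesis by (simp add: deriv_X_def cscale_def)
    qed (auto simp: deriv_X_def cscale_def)
  qed
qed

text \<open>The factorisation of \<open>\<R>\<^sub>\<sigma>\<close> through \<open>\<H>\<close> used to motivate the definition of \<^const>\<open>Rop\<close>.\<close>

lemma Rop_factorisation:
  assumes "\<tau> K > 0" "\<phi> \<in> Rop_dom K \<tau> H"
  shows "Rop K \<tau> \<sigma> \<phi> = Hop K \<tau> (Hop K \<tau> \<phi> + cscale \<sigma> \<phi>) - cscale \<sigma> (Hop K \<tau> \<phi> + cscale \<sigma> \<phi>)"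
proof -
  have "deriv_X (\<tau> K) (deriv_X (\<tau> K) \<phi> + cscale \<sigma> \<phi>) =
      deriv_X (\<tau> K) (deriv_X (\<tau> K) \<phi>) + cscale \<sigma> (deriv_X (\<tau> K) \<phi>)"
    using assms by (intro deriv_X_combination) (auto simp: Rop_dom_def C1_X_def)
  then show ?thesis
    by (simp add: Rop_def Hop_def cscale_def fun_eq_iff vec_eq_iff algebra_simps power2_eq_square)
qed

lemma delay_rhs_combination:
  "delay_rhs K \<tau> H (\<phi> + cscale c \<psi>) = delay_rhs K \<tau> H \<phi> + c *s delay_rhs K \<tau> H \<psi>"
  by (simp add: delay_rhs_def cscale_def matrix_vector_right_distrib vector_scalar_commute
      sum.distrib vector_add_ldistrib algebra_simps)
    (simp add: vec_eq_iff sum_distrib_left algebra_simps)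

lemma Xspace_combination:
  assumes "\<phi> \<in> Xspace T" "\<psi> \<in> Xspace T"
  shows "\<phi> + cscale c (\<psi> :: real \<Rightarrow> complex^'m) \<in> Xspace T"
proof -
  have "continuous_on {-T..T} (\<lambda>x. \<phi> x + c *s \<psi> x)"
    using assms unfolding vector_scalar_mult_def Xspace_def
    by (auto intro!: continuous_intros)
  then show ?thesis using assms by (auto simp: Xspace_def cscale_def plus_fun_def)
qed

lemma C1_X_combination:
  assumes "T > 0" "\<phi> \<in> C1_X T" "\<psi> \<in> C1_X T"
  shows "\<phi> + cscale c \<psi> \<in> C1_X T"
  using assms deriv_X_combination[where T=T and \<phi>=\<phi> and \<psi>=\<psi> and c=c] Xspace_combination
  by (auto simp: C1_X_def)

lemma Rop_dom_factorisation:
  assumes "\<tau> K > 0"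
  shows "Rop_dom K \<tau> H = {\<phi> \<in> Hop_dom K \<tau> H. Hop K \<tau> \<phi> + cscale \<sigma> \<phi> \<in> Hop_dom K \<tau> H}"
proof -
  let ?d = "deriv_X (\<tau> K)"
  have "?d \<phi> \<in> C1_X (\<tau> K) \<and> ?d (?d \<phi>) 0 = delay_rhs K \<tau> H (?d \<phi>) \<longleftrightarrow>
      ?d \<phi> + cscale \<sigma> \<phi> \<in> C1_X (\<tau> K) \<and>
      ?d (?d \<phi> + cscale \<sigma> \<phi>) 0 = delay_rhs K \<tau> H (?d \<phi> + cscale \<sigma> \<phi>)"
    if "\<phi> \<in> C1_X (\<tau> K)" and b: "?d \<phi> 0 = delay_rhs K \<tau> H \<phi>" for \<phi>
  proof -
    have eq: "?d \<phi> = (?d \<phi> + cscale \<sigma> \<phi>) + cscale (-\<sigma>) \<phi>"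
      by (simp add: cscale_def fun_eq_iff vec_eq_iff)
    have iff: "?d \<phi> \<in> C1_X (\<tau> K) \<longleftrightarrow> ?d \<phi> + cscale \<sigma> \<phi> \<in> C1_X (\<tau> K)"
      using C1_X_combination[OF assms _ that(1), of "?d \<phi>" \<sigma>]
        C1_X_combination[OF assms _ that(1), of "?d \<phi> + cscale \<sigma> \<phi>" "-\<sigma>"] eq by auto
    have "?d (?d \<phi> + cscale \<sigma> \<phi>) = ?d (?d \<phi>) + cscale \<sigma> (?d \<phi>)" if "?d \<phi> \<in> C1_X (\<tau> K)"
      using assms that \<open>\<phi> \<in> C1_X (\<tau> K)\<close>
      by (intro deriv_X_combination) (auto simp: C1_X_def)
    with iff b show ?thesis
      by (auto simp: delay_rhs_combination) (simp_all add: cscale_def)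
  qed
  then show ?thesis by (auto simp: Rop_dom_def Hop_dom_def Hop_def)
qed

end

theory Submission
  imports Defs
begin

text \<open>
  Write \<open>\<omega>(x, y) = x\<^sup>T J y\<close> and let \<open>C(\<phi>, \<psi>) = B(\<phi>, J\<psi>)\<close> be the form of the theorem. Because of the
  symmetry of the coefficients, \<open>\<omega>(x, H\<^sub>-\<^sub>k y) = \<omega>(y, H\<^sub>k x)\<close>, the form \<open>C\<close> is alternating. Integrating
  by parts, and using the condition at \<open>0\<close> in the domain of \<open>\<H>\<close> to cancel the boundary terms, one
  finds that \<open>\<H>\<close> is skew-adjoint with respect to \<open>C\<close> (lemma \<open>Hop_skew_adjoint\<close>). Hence
  \<open>\<R>\<^sub>\<sigma> = \<H>\<^sup>2 - \<sigma>\<^sup>2\<close> and its inverse \<open>A\<close> are self-adjoint with respect to \<open>C\<close>. Therefore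
  \<open>C(A\<^sup>i f, A\<^sup>j f) = C(f, A\<^sup>i\<^sup>+\<^sup>j f)\<close> is symmetric in \<open>i\<close> and \<open>j\<close>; as \<open>C\<close> is alternating, it is zero
  (lemma \<open>twisted_form_iterates\<close>). By bilinearity \<open>C\<close> vanishes on the span of the \<open>A\<^sup>i f\<close>.

  It remains to see that \<open>A\<close> really inverts \<open>\<R>\<^sub>\<sigma>\<close> from the right, that is, that \<open>\<R>\<^sub>\<sigma>\<close> maps onto the
  space of continuous functions (lemma \<open>Rop_surjective\<close>). Since \<open>\<R>\<^sub>\<sigma> = (\<H> - \<sigma>)(\<H> + \<sigma>)\<close>, it is
  enough to solve \<open>(\<H> - s)\<phi> = g\<close> for \<open>s = \<sigma>\<close> and \<open>s = -\<sigma>\<close>. By variation of constants this reduces to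
  surjectivity of the characteristic matrix \<open>\<Delta>(s)\<close>, a question in finite dimension. The matrix
  \<open>\<Delta>(\<sigma>)\<close> has trivial kernel because \<open>\<sigma>\<close> is not an eigenvalue of \<open>\<H>\<close>, and the identity
  \<open>\<omega>(x, \<Delta>(\<sigma>)y) = \<omega>(y, \<Delta>(-\<sigma>)x)\<close> with the nondegeneracy of \<open>\<omega>\<close> transfers this to \<open>\<Delta>(-\<sigma>)\<close>.
\<close>

section \<open>The symplectic pairing\<close>

definition symp_form :: "complex^('n::finite + 'n) \<Rightarrow> complex^('n + 'n) \<Rightarrow> complex" where
  "symp_form x y = scalar_product x (cmat sympJ *v y)"

lemma scalar_product_commute:
  "scalar_product x y = scalar_product y (x :: 'a::comm_semiring_1^'m)"
  by (simp add: scalar_product_def mult.commute)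

lemma scalar_product_matrix_transpose:
  "scalar_product x (A *v y) = scalar_product y (transpose A *v (x :: 'a::comm_semiring_1^'m))"
  by (simp add: scalar_product_def matrix_vector_mult_def transpose_def sum_distrib_left mult_ac)
    (rule sum.swap)

lemma cmat_transpose: "transpose (cmat A) = cmat (transpose A)"
  by (simp add: vec_eq_iff transpose_def)

lemma cmat_mult_vec: "cmat A *v (cmat B *v x) = cmat (A ** B) *v x"
proof -
  have "cmat (A ** B) = cmat A ** cmat B"
    by (simp add: vec_eq_iff matrix_matrix_mult_def)
  then show ?thesis by (simp add: matrix_vector_mul_assoc)
qed

lemma transpose_sympJ: "transpose sympJ = - (sympJ :: real^('n::finite + 'n)^('n + 'n))"
  by (auto simp: vec_eq_iff transpose_def sympJ_def mat_def split: sum.splits)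

lemma symp_form_swap: "symp_form x y = - symp_form y x"
proof -
  have "cmat (- sympJ) *v x = - (cmat sympJ *v x)"
    by (simp add: vec_eq_iff matrix_vector_mult_def sum_negf)
  then show ?thesis
    unfolding symp_form_def scalar_product_matrix_transpose[of x] cmat_transpose transpose_sympJ
    by (simp add: scalar_product_def sum_negf)
qed

text \<open>
  The form in which the Hamiltonian symmetry \<open>(JA)\<^sup>T = JB\<close> of the coefficients enters every
  computation: \<open>A\<close> on one side is traded for \<open>B\<close> on the other, with the arguments exchanged.
\<close>

lemma symp_form_transpose:
  assumes "transpose (sympJ ** A) = sympJ ** B"
  shows "symp_form x (cmat A *v y) = symp_form y (cmat B *v x)"
  unfolding symp_form_def cmat_mult_vec
  by (subst scalar_product_matrix_transpose) (simp add: cmat_transpose assms)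

lemma symp_form_add_right: "symp_form x (y + z) = symp_form x y + symp_form x z"
  by (simp add: symp_form_def scalar_product_def matrix_vector_right_distrib
      distrib_left sum.distrib)

lemma symp_form_scale_right: "symp_form x (c *s y) = c * symp_form x y"
  by (simp add: symp_form_def scalar_product_def vector_scalar_commute sum_distrib_left mult_ac)

lemma symp_form_add_left: "symp_form (x + y) z = symp_form x z + symp_form y z"
  by (simp add: symp_form_def scalar_product_def distrib_right sum.distrib)

lemma symp_form_scale_left: "symp_form (c *s x) z = c * symp_form x z"
  by (simp add: symp_form_def scalar_product_def sum_distrib_left mult_ac)

lemma scaleR_eq_scale: "r *\<^sub>R x = complex_of_real r *s (x :: complex^'m)"
  by (simp add: vec_eq_iff scaleR_conv_of_real[where 'a=complex])

lemma symp_form_minus_right: "symp_form x (- y) = - symp_form x y"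
  using symp_form_scale_right[of x "-1" y] by simp

lemma symp_form_diff_right: "symp_form x (y - z) = symp_form x y - symp_form x z"
  using symp_form_add_right[of x y "-z"] by (simp add: symp_form_minus_right)

lemma symp_form_zero_right: "symp_form x 0 = 0"
  using symp_form_scale_right[of x 0 0] by simp

lemma symp_form_sum_right: "symp_form x (\<Sum>k\<in>S. f k) = (\<Sum>k\<in>S. symp_form x (f k))"
  by (induction S rule: infinite_finite_induct)
    (simp_all add: symp_form_zero_right symp_form_add_right)

text \<open>
  \<open>J\<close> has the right inverse \<open>-J\<close>, so testing against \<open>y = -J e\<^sub>i\<close> reads off the coordinate \<open>x\<^sub>i\<close>.
\<close>

lemma symp_form_nondegenerate:
  fixes x :: "complex^('n::finite + 'n)"
  assumes "\<And>y. symp_form x y = 0"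
  shows "x = 0"
proof -
  have "sympJ ** (- sympJ) = (mat 1 :: real^('n + 'n)^('n + 'n))"
  proof -
    have "(sympJ ** (- sympJ)) $ i $ j = (mat 1 :: real^('n + 'n)^('n + 'n)) $ i $ j" for i j
      by (cases i; cases j)
        (simp_all add: matrix_matrix_mult_def sympJ_def mat_def UNIV_Plus_UNIV[symmetric]
          sum.Plus if_distrib[of "\<lambda>x. x * _"] sum_negf cong: if_cong del: UNIV_Plus_UNIV)
    then show ?thesis by (simp add: vec_eq_iff)
  qed
  then have J: "cmat sympJ *v (cmat (- sympJ) *v z) = z" for z :: "complex^('n + 'n)"
    unfolding cmat_mult_vec
    by (simp add: vec_eq_iff matrix_vector_mult_def mat_def if_distrib[of "\<lambda>x. x * _"]
        if_distrib[of complex_of_real] cong: if_cong)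
  have "x $ i = 0" for i
  proof -
    have "symp_form x (cmat (- sympJ) *v axis i 1) = x $ i"
      unfolding symp_form_def J
      by (simp add: scalar_product_def axis_def if_distrib[of "\<lambda>x. _ * x"] cong: if_cong)
    with assms show ?thesis by metis
  qed
  then show ?thesis by (simp add: vec_eq_iff)
qed

lemma bounded_linear_scale: "bounded_linear (\<lambda>v::complex^'m. c *s v)"
  by (intro linear_conv_bounded_linear[THEN iffD1] linearI)
    (auto simp: vec_eq_iff algebra_simps scaleR_conv_of_real)

lemma bounded_linear_cmat: "bounded_linear (\<lambda>v. cmat A *v v)"
  by (intro linear_conv_bounded_linear[THEN iffD1] linearI)
    (simp_all add: matrix_vector_right_distrib scaleR_eq_scale vector_scalar_commute)

lemma bounded_bilinear_symp_form:
  "bounded_bilinear (symp_form :: complex^('n::finite + 'n) \<Rightarrow> _)"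
  unfolding bilinear_conv_bounded_bilinear[symmetric] bilinear_def
  by (intro conjI allI linearI)
    (simp_all add: symp_form_add_right symp_form_add_left scaleR_eq_scale symp_form_scale_right
      symp_form_scale_left scaleR_conv_of_real)

lemma bounded_bilinear_symp_form_cmat:
  "bounded_bilinear (\<lambda>x y. symp_form x (cmat A *v y))"
  by (rule bounded_bilinear.comp[OF bounded_bilinear_symp_form bounded_linear_ident bounded_linear_cmat])

lemmas continuous_on_symp_form_cmat =
  bounded_bilinear.continuous_on[OF bounded_bilinear_symp_form_cmat]

section \<open>Solving the resolvent equation\<close>

lemma C1_X_has_deriv_X:
  assumes "\<phi> \<in> C1_X T" "\<theta> \<in> {-T..T}"
  shows "(\<phi> has_vector_derivative deriv_X T \<phi> \<theta>) (at \<theta> within {-T..T})"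
  using assms by (auto simp: C1_X_def deriv_X_def vector_derivative_works)

text \<open>
  A derivative exhibited by hand is the one that \<^const>\<open>deriv_X\<close> chooses, because one-sided
  derivatives on a nondegenerate interval are unique.
\<close>

lemma C1_X_I:
  fixes \<phi> d :: "real \<Rightarrow> complex^'m"
  assumes T: "T > 0"
    and deriv: "\<And>\<theta>. \<theta> \<in> {-T..T} \<Longrightarrow> (\<phi> has_vector_derivative d \<theta>) (at \<theta> within {-T..T})"
    and zero: "\<And>\<theta>. \<theta> \<notin> {-T..T} \<Longrightarrow> \<phi> \<theta> = 0"
    and d: "d \<in> Xspace T"
  shows "\<phi> \<in> C1_X T" and "deriv_X T \<phi> = d"
proof -
  show eq: "deriv_X T \<phi> = d"
  proof
    fix \<theta> show "deriv_X T \<phi> \<theta> = d \<theta>"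
      using vector_derivative_within_cbox[of "-T" T \<theta> \<phi> "d \<theta>"] deriv[of \<theta>] T d
      by (auto simp: deriv_X_def Xspace_def)
  qed
  have "continuous_on {-T..T} \<phi>"
    by (rule continuous_on_vector_derivative[OF deriv])
  then show "\<phi> \<in> C1_X T"
    using differentiableI_vector[OF deriv] zero d eq by (auto simp: C1_X_def Xspace_def)
qed

definition exp_X :: "real \<Rightarrow> complex \<Rightarrow> complex^'m \<Rightarrow> real \<Rightarrow> complex^'m" where
  "exp_X T \<sigma> c = (\<lambda>\<theta>. if \<theta> \<in> {-T..T} then exp (\<sigma> * complex_of_real \<theta>) *s c else 0)"

text \<open>
  The characteristic matrix \<open>\<Delta>(\<sigma>) = \<sigma>I - H\<^sub>0 - \<Sum>\<^sub>k (H\<^sub>-\<^sub>k e\<^sup>-\<^sup>\<sigma>\<^sup>\<tau> + H\<^sub>k e\<^sup>\<sigma>\<^sup>\<tau>)\<close> of the delay equation, where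
  \<open>\<tau>\<close> abbreviates \<open>\<tau>\<^sub>k\<close>, as a linear map: it measures how far \<open>\<theta> \<mapsto> e\<^sup>\<sigma>\<^sup>\<theta> c\<close> is from satisfying
  the condition at \<open>0\<close> in the domain of \<open>\<H>\<close>.
\<close>

definition char_op ::
  "nat \<Rightarrow> (nat \<Rightarrow> real) \<Rightarrow> (int \<Rightarrow> real^'m^'m) \<Rightarrow> complex \<Rightarrow> complex^'m \<Rightarrow> complex^'m" where
  "char_op K \<tau> H \<sigma> c = \<sigma> *s c - delay_rhs K \<tau> H (exp_X (\<tau> K) \<sigma> c)"

lemma exp_scale_has_vector_derivative:
  fixes p :: "real \<Rightarrow> complex^'m"
  assumes "(p has_vector_derivative q) (at \<theta> within S)"
  shows "((\<lambda>t. exp (\<sigma> * complex_of_real t) *s p t) has_vector_derivative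
     exp (\<sigma> * complex_of_real \<theta>) *s q + \<sigma> *s (exp (\<sigma> * complex_of_real \<theta>) *s p \<theta>)) (at \<theta> within S)"
proof -
  have bb: "bounded_bilinear (\<lambda>z (v :: complex^'m). z *s v)"
    unfolding bilinear_conv_bounded_bilinear[symmetric] bilinear_def
    by (intro conjI allI linearI)
      (simp_all add: vector_add_ldistrib vector_sadd_rdistrib scaleR_eq_scale
        vector_smult_assoc scaleR_conv_of_real[where 'a=complex] mult.commute)
  have "((\<lambda>t. exp (\<sigma> * complex_of_real t)) has_vector_derivative
      \<sigma> * exp (\<sigma> * complex_of_real \<theta>)) (at \<theta> within S)"
    by (rule has_vector_derivative_at_within, rule has_vector_derivative_real_field)
      (auto intro!: derivative_eq_intros)
  from bounded_bilinear.has_vector_derivative[OF bb this assms]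
  show ?thesis by (simp add: vector_smult_assoc)
qed

lemma exp_X_outside: "\<theta> \<notin> {-T..T} \<Longrightarrow> exp_X T \<sigma> c \<theta> = 0"
  unfolding exp_X_def by (rule if_not_P)

lemma exp_X_C1:
  fixes c :: "complex^'m"
  assumes T: "T > 0"
  shows "exp_X T \<sigma> c \<in> C1_X T" and "deriv_X T (exp_X T \<sigma> c) = cscale \<sigma> (exp_X T \<sigma> c)"
proof -
  have deriv: "(exp_X T \<sigma> c has_vector_derivative cscale \<sigma> (exp_X T \<sigma> c) \<theta>) (at \<theta> within {-T..T})"
    if "\<theta> \<in> {-T..T}" for \<theta>
  proof (rule has_vector_derivative_transform[OF that])
    show "exp_X T \<sigma> c t = exp (\<sigma> * complex_of_real t) *s c" if "t \<in> {-T..T}" for t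
      using that by (simp add: exp_X_def)
    show "((\<lambda>t. exp (\<sigma> * complex_of_real t) *s c) has_vector_derivative
        cscale \<sigma> (exp_X T \<sigma> c) \<theta>) (at \<theta> within {-T..T})"
      using exp_scale_has_vector_derivative[OF has_vector_derivative_const, of \<sigma> c \<theta>] that
      by (simp add: cscale_def exp_X_def)
  qed
  have "continuous_on {-T..T} (exp_X T \<sigma> c)"
    by (rule continuous_on_vector_derivative[OF deriv])
  then have "cscale \<sigma> (exp_X T \<sigma> c) \<in> Xspace T"
    by (auto simp: Xspace_def cscale_def exp_X_def
        intro: bounded_linear.continuous_on[OF bounded_linear_scale])
  from C1_X_I[OF T deriv exp_X_outside this]
  show "exp_X T \<sigma> c \<in> C1_X T" "deriv_X T (exp_X T \<sigma> c) = cscale \<sigma> (exp_X T \<sigma> c)"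
    by simp_all
qed

lemma exp_X_zero: "T > 0 \<Longrightarrow> exp_X T \<sigma> c 0 = c"
  by (simp add: exp_X_def)

text \<open>
  Variation of constants for \<open>p' = \<sigma>p + g\<close>, without any condition at \<open>0\<close>. The primitive is taken
  from the left end point of the interval, so that no integral over a reversed interval occurs.
\<close>

lemma inhomogeneous_solution:
  fixes g :: "real \<Rightarrow> complex^'m"
  assumes T: "T > 0" and g: "g \<in> Xspace T"
  obtains p where "p \<in> C1_X T" "deriv_X T p = cscale \<sigma> p + g"
proof
  define h where "h s = exp (- \<sigma> * complex_of_real s) *s g s" for s
  define P where "P u = integral {-T..u} h" for u
  define p where "p \<theta> = (if \<theta> \<in> {-T..T} then exp (\<sigma> * complex_of_real \<theta>) *s P \<theta> else 0)" for \<theta>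
  have "continuous_on {-T..T} h"
    unfolding h_def vector_scalar_mult_def using g
    by (auto simp: Xspace_def intro!: continuous_intros)
  then have P: "(P has_vector_derivative h \<theta>) (at \<theta> within {-T..T})" if "\<theta> \<in> {-T..T}" for \<theta>
    unfolding P_def using that by (rule integral_has_vector_derivative)
  have deriv: "(p has_vector_derivative (cscale \<sigma> p + g) \<theta>) (at \<theta> within {-T..T})"
    if "\<theta> \<in> {-T..T}" for \<theta>
  proof (rule has_vector_derivative_transform[OF that])
    show "p t = exp (\<sigma> * complex_of_real t) *s P t" if "t \<in> {-T..T}" for t
      using that by (simp add: p_def)
    have "exp (\<sigma> * complex_of_real \<theta>) *s h \<theta> = g \<theta>"
      by (simp add: h_def vector_smult_assoc exp_minus)
    then show "((\<lambda>t. exp (\<sigma> * complex_of_real t) *s P t) has_vector_derivative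
        (cscale \<sigma> p + g) \<theta>) (at \<theta> within {-T..T})"
      using exp_scale_has_vector_derivative[OF P[OF that], of \<sigma>] that
      by (simp add: cscale_def p_def add.commute)
  qed
  have "continuous_on {-T..T} p"
    by (rule continuous_on_vector_derivative[OF deriv])
  then have "g + cscale \<sigma> p \<in> Xspace T"
    using g by (intro Xspace_combination) (auto simp: Xspace_def p_def)
  then have X: "cscale \<sigma> p + g \<in> Xspace T" by (simp add: add.commute)
  have "p \<theta> = 0" if "\<theta> \<notin> {-T..T}" for \<theta>
    unfolding p_def using that by (rule if_not_P)
  from C1_X_I[OF T deriv this X]
  show "p \<in> C1_X T" "deriv_X T p = cscale \<sigma> p + g"
    by simp_all
qed

text \<open>
  Adding \<open>e\<^sup>\<sigma>\<^sup>\<theta> c\<close> to a particular solution of \<open>\<phi>' - \<sigma>\<phi> = g\<close> gives all solutions; the condition at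
  \<open>0\<close> then becomes a linear equation \<open>\<Delta>(\<sigma>)c = v\<close> for the free vector \<open>c\<close>.
\<close>

lemma Hop_resolvent_surjective:
  fixes g :: "real \<Rightarrow> complex^'m"
  assumes T: "\<tau> K > 0" and surj: "surj (char_op K \<tau> H \<sigma>)" and g: "g \<in> Xspace (\<tau> K)"
  obtains \<phi> where "\<phi> \<in> Hop_dom K \<tau> H" "Hop K \<tau> \<phi> - cscale \<sigma> \<phi> = g"
proof -
  obtain p where p: "p \<in> C1_X (\<tau> K)" "deriv_X (\<tau> K) p = cscale \<sigma> p + g"
    using inhomogeneous_solution[OF T g] by blast
  obtain c where c: "char_op K \<tau> H \<sigma> c = delay_rhs K \<tau> H p - deriv_X (\<tau> K) p 0"
    using surj by (metis surjD)
  define e where "e = exp_X (\<tau> K) \<sigma> c"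
  have e: "e \<in> C1_X (\<tau> K)" "deriv_X (\<tau> K) e = cscale \<sigma> e" "e 0 = c"
    using exp_X_C1[OF T] exp_X_zero[OF T] by (auto simp: e_def)
  have C1: "p + cscale 1 e \<in> C1_X (\<tau> K)"
    using T p(1) e(1) by (rule C1_X_combination)
  have d: "deriv_X (\<tau> K) (p + cscale 1 e) = deriv_X (\<tau> K) p + cscale 1 (deriv_X (\<tau> K) e)"
    using T p(1) e(1) by (intro deriv_X_combination) (auto simp: C1_X_def)
  have "deriv_X (\<tau> K) (p + cscale 1 e) 0 = delay_rhs K \<tau> H (p + cscale 1 e)"
    unfolding d delay_rhs_combination using c
    by (simp add: e cscale_def char_op_def e_def[symmetric] algebra_simps)
  with C1 have "p + cscale 1 e \<in> Hop_dom K \<tau> H" by (simp add: Hop_dom_def)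
  moreover have "Hop K \<tau> (p + cscale 1 e) - cscale \<sigma> (p + cscale 1 e) = g"
    unfolding Hop_def d p(2) e(2)
    by (simp add: cscale_def fun_eq_iff vec_eq_iff algebra_simps)
  ultimately show ?thesis by (rule that)
qed

lemma linear_char_op: "linear (char_op K \<tau> H \<sigma>)"
proof -
  have comb: "char_op K \<tau> H \<sigma> (x + c *s y) = char_op K \<tau> H \<sigma> x + c *s char_op K \<tau> H \<sigma> y" for x y c
  proof -
    have "exp_X (\<tau> K) \<sigma> (x + c *s y) = exp_X (\<tau> K) \<sigma> x + cscale c (exp_X (\<tau> K) \<sigma> y)"
      by (simp add: exp_X_def cscale_def fun_eq_iff vec_eq_iff algebra_simps)
    then show ?thesis
      by (simp add: char_op_def delay_rhs_combination vec_eq_iff algebra_simps)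
  qed
  have zero: "char_op K \<tau> H \<sigma> 0 = 0"
    using comb[of 0 "-1" 0] by simp
  show ?thesis
    using comb[of _ 1] comb[of 0] zero by (intro linearI) (simp_all add: scaleR_eq_scale)
qed

lemma surj_iff_kernel_char_op:
  "surj (char_op K \<tau> H \<sigma>) \<longleftrightarrow> (\<forall>c. char_op K \<tau> H \<sigma> c = 0 \<longrightarrow> c = 0)"
proof -
  have "surj (char_op K \<tau> H \<sigma>) \<longleftrightarrow> inj (char_op K \<tau> H \<sigma>)"
    using linear_injective_imp_surjective linear_surjective_imp_injective linear_char_op by metis
  then show ?thesis by (simp add: linear_injective_0[OF linear_char_op])
qed

text \<open>
  A nonzero \<open>c\<close> in the kernel of \<open>\<Delta>(\<sigma>)\<close> would make \<open>e\<^sup>\<sigma>\<^sup>\<theta> c\<close> an eigenfunction of \<open>\<H>\<close>; in finite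
  dimension a trivial kernel is as good as surjectivity.
\<close>

lemma surj_char_op_if_not_eigenvalue:
  assumes T: "\<tau> K > 0" and "\<not> Hop_eigenvalue K \<tau> H \<sigma>"
  shows "surj (char_op K \<tau> H \<sigma>)"
  unfolding surj_iff_kernel_char_op
proof (intro allI impI)
  fix c assume c: "char_op K \<tau> H \<sigma> c = 0"
  let ?e = "exp_X (\<tau> K) \<sigma> c"
  have "?e \<in> Hop_dom K \<tau> H"
    using exp_X_C1[OF T, of \<sigma> c] exp_X_zero[OF T, of \<sigma> c] c
    by (simp add: Hop_dom_def char_op_def cscale_def)
  moreover have "Hop K \<tau> ?e = cscale \<sigma> ?e"
    unfolding Hop_def by (rule exp_X_C1[OF T])
  ultimately have "?e = 0"
    using assms(2) by (auto simp: Hop_eigenvalue_def)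
  then show "c = 0" using exp_X_zero[OF T, of \<sigma> c] by simp
qed


section \<open>Integration by parts over one delay\<close>

text \<open>
  The integral contributed by a single delay. The integrals with \<open>H\<^sub>k\<close> in \<^const>\<open>Bform\<close> are, by the
  Hamiltonian symmetry, the same expression in \<open>H\<^sub>-\<^sub>k\<close> with the two functions exchanged, so this one
  kind suffices.
\<close>

definition delay_pairing :: "real \<Rightarrow> real^('n::finite + 'n)^('n + 'n) \<Rightarrow>
    (real \<Rightarrow> complex^('n + 'n)) \<Rightarrow> (real \<Rightarrow> complex^('n + 'n)) \<Rightarrow> complex" where
  "delay_pairing t A \<phi> \<psi> = integral {0..t} (\<lambda>\<theta>. symp_form (\<psi> \<theta>) (cmat A *v \<phi> (\<theta> - t)))"

lemma continuous_on_delay_integrand: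
  assumes "\<phi> \<in> Xspace T" "\<psi> \<in> Xspace T" "t \<le> T" "0 \<le> t"
  shows "continuous_on {0..t} (\<lambda>\<theta>. symp_form (\<psi> \<theta>) (cmat A *v \<phi> (\<theta> - t)))"
proof (rule continuous_on_symp_form_cmat)
  have c: "continuous_on {-T..T} \<phi>" "continuous_on {-T..T} \<psi>"
    using assms by (auto simp: Xspace_def)
  show "continuous_on {0..t} \<psi>"
    using c(2) by (rule continuous_on_subset) (use assms in auto)
  show "continuous_on {0..t} (\<lambda>\<theta>. \<phi> (\<theta> - t))"
    by (rule continuous_on_compose2[OF c(1)]) (use assms in \<open>auto intro!: continuous_intros\<close>)
qed

lemma delay_pairing_combination:
  assumes "\<phi> \<in> Xspace T" "\<rho> \<in> Xspace T" "\<psi> \<in> Xspace T" "t \<le> T" "0 \<le> t"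
  shows "delay_pairing t A (\<phi> + cscale c \<rho>) \<psi> = delay_pairing t A \<phi> \<psi> + c * delay_pairing t A \<rho> \<psi>"
    and "delay_pairing t A \<psi> (\<phi> + cscale c \<rho>) = delay_pairing t A \<psi> \<phi> + c * delay_pairing t A \<psi> \<rho>"
proof -
  note int = integrable_continuous_real[OF continuous_on_delay_integrand[OF _ _ assms(4,5)]]
  show "delay_pairing t A (\<phi> + cscale c \<rho>) \<psi> = delay_pairing t A \<phi> \<psi> + c * delay_pairing t A \<rho> \<psi>"
    unfolding delay_pairing_def cscale_def plus_fun_def matrix_vector_right_distrib
      vector_scalar_commute symp_form_add_right symp_form_scale_right
    using int assms(1-3) by (subst integral_add) (auto intro: integrable_on_mult_right)
  show "delay_pairing t A \<psi> (\<phi> + cscale c \<rho>) = delay_pairing t A \<psi> \<phi> + c * delay_pairing t A \<psi> \<rho>"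
    unfolding delay_pairing_def cscale_def plus_fun_def symp_form_add_left symp_form_scale_left
    using int assms(1-3) by (subst integral_add) (auto intro: integrable_on_mult_right)
qed

text \<open>
  The two integrands add up to the derivative of \<open>\<theta> \<mapsto> \<psi>(\<theta>)\<^sup>T J A \<phi>(\<theta> - t)\<close>, and only the boundary
  terms at \<open>\<theta> = t\<close> and \<open>\<theta> = 0\<close> remain.
\<close>

lemma delay_pairing_by_parts:
  assumes \<phi>: "\<phi> \<in> C1_X T" and \<psi>: "\<psi> \<in> C1_X T" and t: "0 \<le> t" "t \<le> T"
  shows "delay_pairing t A (deriv_X T \<phi>) \<psi> + delay_pairing t A \<phi> (deriv_X T \<psi>) =
    symp_form (\<psi> t) (cmat A *v \<phi> 0) - symp_form (\<psi> 0) (cmat A *v \<phi> (- t))"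
proof -
  let ?w = "\<lambda>x y. symp_form x (cmat A *v y)"
  have X: "\<phi> \<in> Xspace T" "\<psi> \<in> Xspace T" "deriv_X T \<phi> \<in> Xspace T" "deriv_X T \<psi> \<in> Xspace T"
    using \<phi> \<psi> by (auto simp: C1_X_def)
  have "((\<lambda>\<theta>. ?w (\<psi> \<theta>) (\<phi> (\<theta> - t))) has_vector_derivative
      ?w (\<psi> \<theta>) (deriv_X T \<phi> (\<theta> - t)) + ?w (deriv_X T \<psi> \<theta>) (\<phi> (\<theta> - t))) (at \<theta> within {0..t})"
    if \<theta>: "\<theta> \<in> {0..t}" for \<theta>
  proof (rule bounded_bilinear.has_vector_derivative[OF bounded_bilinear_symp_form_cmat])
    show "(\<psi> has_vector_derivative deriv_X T \<psi> \<theta>) (at \<theta> within {0..t})"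
      by (rule has_vector_derivative_within_subset[OF C1_X_has_deriv_X[OF \<psi>]]) (use \<theta> t in auto)
    have 1: "((\<lambda>s. s - t) has_vector_derivative 1) (at \<theta> within {0..t})"
      by (auto intro!: derivative_eq_intros)
    have 2: "(\<phi> has_vector_derivative deriv_X T \<phi> (\<theta> - t)) (at (\<theta> - t) within (\<lambda>s. s - t) ` {0..t})"
      by (rule has_vector_derivative_within_subset[OF C1_X_has_deriv_X[OF \<phi>]]) (use \<theta> t in auto)
    show "((\<lambda>s. \<phi> (s - t)) has_vector_derivative deriv_X T \<phi> (\<theta> - t)) (at \<theta> within {0..t})"
      using vector_diff_chain_within[OF 1 2] by (simp add: o_def)
  qed
  from fundamental_theorem_of_calculus[OF t(1) this]
  have "integral {0..t} (\<lambda>\<theta>. ?w (\<psi> \<theta>) (deriv_X T \<phi> (\<theta> - t)) + ?w (deriv_X T \<psi> \<theta>) (\<phi> (\<theta> - t))) =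
      ?w (\<psi> t) (\<phi> 0) - ?w (\<psi> 0) (\<phi> (- t))"
    by (simp add: integral_unique)
  then show ?thesis
    unfolding delay_pairing_def
    by (subst (asm) integral_add)
      (auto intro: integrable_continuous_real continuous_on_delay_integrand[OF _ _ t(2,1)] X)
qed

section \<open>The twisted form and its skew-adjoint operator\<close>

interpretation fun_space: vector_space cscale
  by (rule vector_space_cscale)

lemma subspace_Xspace: "fun_space.subspace (Xspace T)"
proof -
  have zero: "0 \<in> Xspace T" by (simp add: Xspace_def zero_fun_def)
  then show ?thesis
    unfolding fun_space.subspace_def
    using Xspace_combination[of _ T _ 1] Xspace_combination[OF zero] by auto
qed

locale hamiltonian_delay_system =
  fixes K :: nat and \<tau> :: "nat \<Rightarrow> real" and H :: "int \<Rightarrow> real^('n::finite + 'n)^('n + 'n)"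
  assumes delay_range: "k \<in> {1..K} \<Longrightarrow> 0 < \<tau> k \<and> \<tau> k \<le> \<tau> K"
    and max_delay_pos: "0 < \<tau> K"
    and hamiltonian_0: "transpose (sympJ ** H 0) = sympJ ** H 0"
    and hamiltonian: "k \<in> {1..K} \<Longrightarrow> transpose (sympJ ** H (- int k)) = sympJ ** H (int k)"
begin

abbreviation "X \<equiv> Xspace (\<tau> K) :: (real \<Rightarrow> complex^('n + 'n)) set"
abbreviation "D \<equiv> deriv_X (\<tau> K) :: (real \<Rightarrow> complex^('n + 'n)) \<Rightarrow> _"

text \<open>
  Inserting \<open>J\<close> in the second argument turns \<open>B\<close> into the alternating form with respect to which
  \<open>\<H>\<close> is skew-adjoint.
\<close>

definition twisted_form :: "(real \<Rightarrow> complex^('n + 'n)) \<Rightarrow> (real \<Rightarrow> complex^('n + 'n)) \<Rightarrow> complex" where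
  "twisted_form \<phi> \<psi> = Bform K \<tau> H \<phi> (\<lambda>\<theta>. cmat sympJ *v \<psi> \<theta>)"

lemma twisted_form_eq:
  "twisted_form \<phi> \<psi> = symp_form (\<phi> 0) (\<psi> 0) -
     (\<Sum>k=1..K. delay_pairing (\<tau> k) (H (- int k)) \<phi> \<psi> - delay_pairing (\<tau> k) (H (- int k)) \<psi> \<phi>)"
proof -
  have sp: "scalar_product (cmat sympJ *v x) y = - symp_form x y" for x y :: "complex^('n + 'n)"
    by (subst symp_form_swap) (simp add: symp_form_def scalar_product_commute)
  have "symp_form (\<psi> (\<theta> - \<tau> k)) (cmat (H (int k)) *v \<phi> \<theta>) =
      symp_form (\<phi> \<theta>) (cmat (H (- int k)) *v \<psi> (\<theta> - \<tau> k))" if "k \<in> {1..K}" for k \<theta>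
    by (rule symp_form_transpose[OF hamiltonian[OF that], symmetric])
  then have "(\<Sum>k=1..K.
        integral {0..\<tau> k} (\<lambda>\<theta>. - symp_form (\<psi> \<theta>) (cmat (H (- int k)) *v \<phi> (\<theta> - \<tau> k))) -
        integral {0..\<tau> k} (\<lambda>\<theta>. - symp_form (\<psi> (\<theta> - \<tau> k)) (cmat (H (int k)) *v \<phi> \<theta>))) =
      - (\<Sum>k=1..K. delay_pairing (\<tau> k) (H (- int k)) \<phi> \<psi> - delay_pairing (\<tau> k) (H (- int k)) \<psi> \<phi>)"
    unfolding sum_negf[symmetric] delay_pairing_def by (intro sum.cong refl) simp
  then show ?thesis
    unfolding twisted_form_def Bform_def sp by (simp add: symp_form_swap[of "\<phi> 0"])
qed

text \<open>
  Both the symplectic pairing at \<open>0\<close> and the difference of integrals change sign when the two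
  functions are exchanged.
\<close>

lemma twisted_form_swap: "twisted_form \<phi> \<psi> = - twisted_form \<psi> \<phi>"
  unfolding twisted_form_eq symp_form_swap[of "\<phi> 0"] by (simp add: sum_subtractf)

lemma twisted_form_combination_left:
  assumes "\<phi> \<in> X" "\<rho> \<in> X" "\<psi> \<in> X"
  shows "twisted_form (\<phi> + cscale c \<rho>) \<psi> = twisted_form \<phi> \<psi> + c * twisted_form \<rho> \<psi>"
proof -
  let ?P = "\<lambda>k. delay_pairing (\<tau> k) (H (- int k))"
  have "?P k (\<phi> + cscale c \<rho>) \<psi> - ?P k \<psi> (\<phi> + cscale c \<rho>) =
      (?P k \<phi> \<psi> - ?P k \<psi> \<phi>) + c * (?P k \<rho> \<psi> - ?P k \<psi> \<rho>)" if "k \<in> {1..K}" for k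
    using delay_pairing_combination[OF assms, of "\<tau> k" "H (- int k)" c] delay_range[OF that]
    by (simp add: algebra_simps)
  then have "(\<Sum>k=1..K. ?P k (\<phi> + cscale c \<rho>) \<psi> - ?P k \<psi> (\<phi> + cscale c \<rho>)) =
      (\<Sum>k=1..K. ?P k \<phi> \<psi> - ?P k \<psi> \<phi>) + c * (\<Sum>k=1..K. ?P k \<rho> \<psi> - ?P k \<psi> \<rho>)"
    unfolding sum_distrib_left sum.distrib[symmetric] by (rule sum.cong[OF refl])
  then show ?thesis
    unfolding twisted_form_eq
    by (simp add: symp_form_add_left symp_form_scale_left cscale_def[of c \<rho>, THEN fun_cong]
        algebra_simps)
qed

lemma twisted_form_combination_right:
  assumes "\<phi> \<in> X" "\<rho> \<in> X" "\<psi> \<in> X"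
  shows "twisted_form \<psi> (\<phi> + cscale c \<rho>) = twisted_form \<psi> \<phi> + c * twisted_form \<psi> \<rho>"
  using twisted_form_combination_left[OF assms, of c] by (simp add: twisted_form_swap[of \<psi>])

lemma symp_form_delay_rhs:
  "symp_form x (delay_rhs K \<tau> H \<phi>) = symp_form x (cmat (H 0) *v \<phi> 0) +
    (\<Sum>k=1..K. symp_form x (cmat (H (- int k)) *v \<phi> (- \<tau> k)) +
       symp_form (\<phi> (\<tau> k)) (cmat (H (- int k)) *v x))"
proof -
  have "(\<Sum>k=1..K. symp_form x (cmat (H (- int k)) *v \<phi> (- \<tau> k)) +
        symp_form x (cmat (H (int k)) *v \<phi> (\<tau> k))) =
      (\<Sum>k=1..K. symp_form x (cmat (H (- int k)) *v \<phi> (- \<tau> k)) +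
        symp_form (\<phi> (\<tau> k)) (cmat (H (- int k)) *v x))"
    using symp_form_transpose[OF hamiltonian] by (intro sum.cong refl) simp
  then show ?thesis
    unfolding delay_rhs_def symp_form_add_right symp_form_sum_right by simp
qed

text \<open>
  Integration by parts turns the integrals into values of \<open>\<phi>\<close> and \<open>\<psi>\<close> at \<open>0\<close> and \<open>\<tau>\<^sub>k\<close>, \<open>-\<tau>\<^sub>k\<close>. The
  condition at \<open>0\<close> in the domain of \<open>\<H>\<close> expresses \<open>\<phi>'(0)\<close> and \<open>\<psi>'(0)\<close> by the same values, and the
  two contributions cancel; the terms with \<open>H\<^sub>0\<close> cancel because \<open>JH\<^sub>0\<close> is symmetric.
\<close>

lemma Hop_skew_adjoint:
  assumes \<phi>: "\<phi> \<in> Hop_dom K \<tau> H" and \<psi>: "\<psi> \<in> Hop_dom K \<tau> H"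
  shows "twisted_form (D \<phi>) \<psi> = - twisted_form \<phi> (D \<psi>)"
proof -
  let ?P = "\<lambda>k. delay_pairing (\<tau> k) (H (- int k))"
  let ?w = "\<lambda>k x y. symp_form x (cmat (H (- int k)) *v y)"
  have C1: "\<phi> \<in> C1_X (\<tau> K)" "\<psi> \<in> C1_X (\<tau> K)"
    and bc: "D \<phi> 0 = delay_rhs K \<tau> H \<phi>" "D \<psi> 0 = delay_rhs K \<tau> H \<psi>"
    using \<phi> \<psi> by (auto simp: Hop_dom_def)
  have parts: "(?P k (D \<phi>) \<psi> - ?P k \<psi> (D \<phi>)) + (?P k \<phi> (D \<psi>) - ?P k (D \<psi>) \<phi>) =
      (?w k (\<psi> (\<tau> k)) (\<phi> 0) - ?w k (\<psi> 0) (\<phi> (- \<tau> k))) -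
      (?w k (\<phi> (\<tau> k)) (\<psi> 0) - ?w k (\<phi> 0) (\<psi> (- \<tau> k)))" if "k \<in> {1..K}" for k
    using delay_pairing_by_parts[OF C1, of "\<tau> k" "H (- int k)"]
      delay_pairing_by_parts[OF C1(2,1), of "\<tau> k" "H (- int k)"] delay_range[OF that]
    by (simp add: algebra_simps)
  have "twisted_form (D \<phi>) \<psi> + twisted_form \<phi> (D \<psi>) =
      symp_form (\<phi> 0) (D \<psi> 0) - symp_form (\<psi> 0) (D \<phi> 0) -
      (\<Sum>k=1..K. (?P k (D \<phi>) \<psi> - ?P k \<psi> (D \<phi>)) + (?P k \<phi> (D \<psi>) - ?P k (D \<psi>) \<phi>))"
    unfolding twisted_form_eq symp_form_swap[of "D \<phi> 0"] sum.distrib by simp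
  also have "(\<Sum>k=1..K. (?P k (D \<phi>) \<psi> - ?P k \<psi> (D \<phi>)) + (?P k \<phi> (D \<psi>) - ?P k (D \<psi>) \<phi>)) =
      (\<Sum>k=1..K. (?w k (\<psi> (\<tau> k)) (\<phi> 0) - ?w k (\<psi> 0) (\<phi> (- \<tau> k))) -
      (?w k (\<phi> (\<tau> k)) (\<psi> 0) - ?w k (\<phi> 0) (\<psi> (- \<tau> k))))"
    using parts by (rule sum.cong[OF refl])
  also have "symp_form (\<phi> 0) (D \<psi> 0) - symp_form (\<psi> 0) (D \<phi> 0) - \<dots> = 0"
    unfolding bc symp_form_delay_rhs symp_form_transpose[OF hamiltonian_0, of "\<phi> 0"]
    by (simp add: sum.distrib sum_subtractf algebra_simps)
  finally show ?thesis by (simp add: eq_neg_iff_add_eq_0)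
qed

lemma Rop_dom_imp:
  assumes "\<phi> \<in> Rop_dom K \<tau> H"
  shows "\<phi> \<in> Hop_dom K \<tau> H" "D \<phi> \<in> Hop_dom K \<tau> H" "\<phi> \<in> X" "D (D \<phi>) \<in> X"
  using assms by (auto simp: Rop_dom_def Hop_dom_def C1_X_def)

text \<open>
  Moving the two derivatives in \<open>\<phi>''\<close> across one after the other costs two signs. This uses that
  \<open>\<phi>'\<close> and \<open>\<psi>'\<close> again lie in the domain of \<open>\<H>\<close>.
\<close>

lemma Rop_self_adjoint:
  assumes \<phi>: "\<phi> \<in> Rop_dom K \<tau> H" and \<psi>: "\<psi> \<in> Rop_dom K \<tau> H"
  shows "twisted_form (Rop K \<tau> \<sigma> \<phi>) \<psi> = twisted_form \<phi> (Rop K \<tau> \<sigma> \<psi>)"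
proof -
  have R: "Rop K \<tau> \<sigma> \<rho> = D (D \<rho>) + cscale (- \<sigma>\<^sup>2) \<rho>" for \<rho> :: "real \<Rightarrow> complex^('n + 'n)"
    by (simp add: Rop_def cscale_def fun_eq_iff vec_eq_iff)
  note d = Rop_dom_imp[OF \<phi>] Rop_dom_imp[OF \<psi>]
  have "twisted_form (D (D \<phi>)) \<psi> = twisted_form \<phi> (D (D \<psi>))"
    using Hop_skew_adjoint[OF d(2,5)] Hop_skew_adjoint[OF d(1,6)] by simp
  then show ?thesis
    unfolding R twisted_form_combination_left[OF d(4,3,7)] twisted_form_combination_right[OF d(8,7,3)]
    by simp
qed

section \<open>Surjectivity of \<open>\<R>\<^sub>\<sigma>\<close>\<close>

text \<open>
  That is, \<open>(J\<Delta>(\<sigma>))\<^sup>T = J\<Delta>(-\<sigma>)\<close>: transposition exchanges \<open>H\<^sub>k\<close> and \<open>H\<^sub>-\<^sub>k\<close>, hence the exponentials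
  \<open>e\<^sup>\<sigma>\<^sup>\<tau>\<close> and \<open>e\<^sup>-\<^sup>\<sigma>\<^sup>\<tau>\<close>, and reverses the sign of \<open>J\<close>.
\<close>

lemma char_op_adjoint:
  "symp_form x (char_op K \<tau> H \<sigma> y) = symp_form y (char_op K \<tau> H (- \<sigma>) x)"
proof -
  have e: "exp_X (\<tau> K) s c 0 = c"
    "k \<in> {1..K} \<Longrightarrow> exp_X (\<tau> K) s c (\<tau> k) = exp (s * complex_of_real (\<tau> k)) *s c"
    "k \<in> {1..K} \<Longrightarrow> exp_X (\<tau> K) s c (- \<tau> k) = exp (- s * complex_of_real (\<tau> k)) *s c"
    for s and c :: "complex^('n + 'n)" and k
    using delay_range[of k] max_delay_pos by (auto simp: exp_X_def)
  have "(\<Sum>k=1..K. symp_form x (cmat (H (- int k)) *v exp_X (\<tau> K) \<sigma> y (- \<tau> k)) +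
        symp_form (exp_X (\<tau> K) \<sigma> y (\<tau> k)) (cmat (H (- int k)) *v x)) =
      (\<Sum>k=1..K. symp_form y (cmat (H (- int k)) *v exp_X (\<tau> K) (- \<sigma>) x (- \<tau> k)) +
        symp_form (exp_X (\<tau> K) (- \<sigma>) x (\<tau> k)) (cmat (H (- int k)) *v y))"
    by (intro sum.cong refl)
      (simp add: e symp_form_scale_left symp_form_scale_right vector_scalar_commute)
  then show ?thesis
    unfolding char_op_def symp_form_diff_right symp_form_delay_rhs e(1) symp_form_scale_right
      symp_form_transpose[OF hamiltonian_0, of x]
    by (simp add: symp_form_swap[of x y])
qed

text \<open>
  The symmetry of the Hamiltonian spectrum about the origin: a vector in the kernel of \<open>\<Delta>(-\<sigma>)\<close>
  pairs to zero with the whole range of \<open>\<Delta>(\<sigma>)\<close>.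
\<close>

lemma surj_char_op_uminus:
  assumes "surj (char_op K \<tau> H \<sigma>)"
  shows "surj (char_op K \<tau> H (- \<sigma>))"
  unfolding surj_iff_kernel_char_op
proof (intro allI impI)
  fix x assume "char_op K \<tau> H (- \<sigma>) x = 0"
  then have "symp_form x (char_op K \<tau> H \<sigma> y) = 0" for y
    by (simp add: char_op_adjoint symp_form_zero_right)
  then have "symp_form x z = 0" for z
    using assms by (metis surjD)
  then show "x = 0" by (rule symp_form_nondegenerate)
qed

text \<open>
  The factors \<open>\<H> - \<sigma>\<close> and \<open>\<H> + \<sigma>\<close> are solved one after the other; that the solution of the first
  equation lies in the domain of \<open>\<H>\<close> is what puts the second solution into the domain of \<open>\<R>\<^sub>\<sigma>\<close>.
\<close>

lemma Rop_surjective: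
  assumes "\<not> Hop_eigenvalue K \<tau> H \<sigma>" and g: "g \<in> X"
  shows "g \<in> Rop K \<tau> \<sigma> ` Rop_dom K \<tau> H"
proof -
  have surj: "surj (char_op K \<tau> H \<sigma>)" "surj (char_op K \<tau> H (- \<sigma>))"
    using surj_char_op_if_not_eigenvalue[OF max_delay_pos assms(1)] surj_char_op_uminus by auto
  obtain \<rho> where \<rho>: "\<rho> \<in> Hop_dom K \<tau> H" "Hop K \<tau> \<rho> - cscale \<sigma> \<rho> = g"
    using Hop_resolvent_surjective[OF max_delay_pos surj(1) g] by blast
  then have "\<rho> \<in> X" by (simp add: Hop_dom_def C1_X_def)
  then obtain \<phi> where \<phi>: "\<phi> \<in> Hop_dom K \<tau> H" "Hop K \<tau> \<phi> - cscale (- \<sigma>) \<phi> = \<rho>"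
    using Hop_resolvent_surjective[OF max_delay_pos surj(2)] by blast
  have eq: "Hop K \<tau> \<phi> + cscale \<sigma> \<phi> = \<rho>"
    using \<phi>(2) by (simp add: cscale_def fun_eq_iff vec_eq_iff)
  have dom: "\<phi> \<in> Rop_dom K \<tau> H"
    unfolding Rop_dom_factorisation[of \<tau> K H \<sigma>, OF max_delay_pos] using \<phi>(1) \<rho>(1) eq by simp
  show ?thesis
    using Rop_factorisation[OF max_delay_pos dom, of \<sigma>] \<rho>(2) eq dom by auto
qed

section \<open>Vanishing on Krylov subspaces\<close>

context
  fixes \<sigma> :: complex
  assumes not_eigenvalue: "\<not> Hop_eigenvalue K \<tau> H \<sigma>"
begin

abbreviation "R_inv \<equiv> Rop_inv K \<tau> H \<sigma>"

text \<open>
  For the function chosen by \<^const>\<open>inv_into\<close>, surjectivity of \<open>\<R>\<^sub>\<sigma>\<close> on the space of continuous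
  functions is exactly what makes it a right inverse.
\<close>

lemma Rop_inv_right_inverse:
  assumes "f \<in> X"
  shows "R_inv f \<in> Rop_dom K \<tau> H" "Rop K \<tau> \<sigma> (R_inv f) = f"
  using Rop_surjective[OF not_eigenvalue assms]
  unfolding Rop_inv_def by (rule inv_into_into, rule f_inv_into_f)

lemma Rop_inv_self_adjoint:
  assumes "f \<in> X" "g \<in> X"
  shows "twisted_form (R_inv f) g = twisted_form f (R_inv g)"
  using Rop_self_adjoint[of "R_inv f" "R_inv g" \<sigma>] assms by (simp add: Rop_inv_right_inverse)

lemma Rop_inv_funpow_in_X: "f \<in> X \<Longrightarrow> (R_inv ^^ j) f \<in> X"
  by (induction j) (auto intro: Rop_dom_imp Rop_inv_right_inverse)

lemma Rop_inv_funpow_self_adjoint: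
  assumes "f \<in> X" "g \<in> X"
  shows "twisted_form ((R_inv ^^ j) f) g = twisted_form f ((R_inv ^^ j) g)"
  using assms
proof (induction j arbitrary: g)
  case (Suc j)
  have "R_inv g \<in> X" using Suc.prems by (auto intro: Rop_dom_imp Rop_inv_right_inverse)
  then have "twisted_form ((R_inv ^^ Suc j) f) g = twisted_form f ((R_inv ^^ j) (R_inv g))"
    using Suc by (simp add: Rop_inv_self_adjoint Rop_inv_funpow_in_X)
  then show ?case by (simp add: funpow_swap1)
qed simp

text \<open>
  With \<open>A\<close> the inverse operator, self-adjointness shows that the value of the form on \<open>A\<^sup>i f\<close> and
  \<open>A\<^sup>j f\<close> depends on \<open>i + j\<close> only, hence is symmetric in \<open>i\<close> and \<open>j\<close>; but it is also antisymmetric.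
\<close>

lemma twisted_form_iterates:
  assumes "f \<in> X"
  shows "twisted_form ((R_inv ^^ i) f) ((R_inv ^^ j) f) = 0"
proof -
  have "twisted_form ((R_inv ^^ i) f) ((R_inv ^^ j) f) = twisted_form f ((R_inv ^^ (i + j)) f)" for i j
    using assms by (simp add: Rop_inv_funpow_self_adjoint Rop_inv_funpow_in_X funpow_add)
  then have "twisted_form ((R_inv ^^ i) f) ((R_inv ^^ j) f) =
      twisted_form ((R_inv ^^ j) f) ((R_inv ^^ i) f)"
    by (metis add.commute)
  then show ?thesis
    using twisted_form_swap[of "(R_inv ^^ i) f" "(R_inv ^^ j) f"] by simp
qed

end

lemma twisted_form_span_left:
  assumes S: "S \<subseteq> X" and g: "g \<in> X" and zero: "\<And>f. f \<in> S \<Longrightarrow> twisted_form f g = 0"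
    and f: "f \<in> fun_space.span S"
  shows "twisted_form f g = 0"
proof -
  have zero_X: "0 \<in> X" by (rule fun_space.subspace_0[OF subspace_Xspace])
  have zero_form: "twisted_form 0 g = 0"
    using twisted_form_combination_left[OF zero_X zero_X g, of "-1"] by simp
  have "fun_space.subspace {f \<in> X. twisted_form f g = 0}"
    unfolding fun_space.subspace_def
    using twisted_form_combination_left[OF _ _ g, of _ _ 1]
      twisted_form_combination_left[OF zero_X _ g] zero_form subspace_Xspace[of "\<tau> K"]
    by (auto simp: fun_space.subspace_def)
  then show ?thesis
    using fun_space.span_minimal[of S "{f \<in> X. twisted_form f g = 0}"] S zero f by auto
qed

text \<open>
  The form is extended linearly in its first argument, and then once more after exchanging the
  arguments.
\<close>

lemma twisted_form_span:
  assumes S: "S \<subseteq> X" and zero: "\<And>f g. f \<in> S \<Longrightarrow> g \<in> S \<Longrightarrow> twisted_form f g = 0"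
    and f: "f \<in> fun_space.span S" and g: "g \<in> fun_space.span S"
  shows "twisted_form f g = 0"
proof -
  have left: "twisted_form f s = 0" if "s \<in> S" for s
    using twisted_form_span_left[OF S _ _ f, of s] S zero that by blast
  have "f \<in> X"
    using fun_space.span_minimal[OF S subspace_Xspace] f by blast
  then have "twisted_form g f = 0"
    using twisted_form_span_left[OF S _ _ g, of f] left twisted_form_swap[of _ f] by simp
  then show ?thesis by (simp add: twisted_form_swap[of f])
qed

end

theorem proposition3p4:
  fixes K m :: nat
    and \<tau> :: "nat \<Rightarrow> real"
    and H :: "int \<Rightarrow> real^('n::finite + 'n)^('n + 'n)"
    and \<sigma> :: complex
    and \<phi>\<^sub>1 \<phi> \<psi> :: "real \<Rightarrow> complex^('n + 'n)"
  assumes "K > 0"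
    and "0 < \<tau> 1"
    and "strict_mono_on {1..K} \<tau>"
    and "transpose (sympJ ** H 0) = sympJ ** H 0"
    and "\<And>k. k \<in> {1..K} \<Longrightarrow> transpose (sympJ ** H (- int k)) = sympJ ** H (int k)"
    and "\<not> Hop_eigenvalue K \<tau> H \<sigma>"
    and "m > 0"
    and "\<phi>\<^sub>1 \<in> Xspace (\<tau> K)"
    and "\<And>\<theta> i. \<theta> \<in> {- \<tau> K..\<tau> K} \<Longrightarrow> \<phi>\<^sub>1 \<theta> $ i \<in> \<real>"
    and "\<phi> \<in> krylov m (Rop_inv K \<tau> H \<sigma>) \<phi>\<^sub>1"
    and "\<psi> \<in> krylov m (Rop_inv K \<tau> H \<sigma>) \<phi>\<^sub>1"
  shows "Bform K \<tau> H \<phi> (\<lambda>\<theta>. cmat sympJ *v \<psi> \<theta>) = 0"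
proof -
  have range: "0 < \<tau> k \<and> \<tau> k \<le> \<tau> K" if "k \<in> {1..K}" for k
  proof -
    have "mono_on {1..K} \<tau>" using assms(3) by (rule strict_mono_on_imp_mono_on)
    then have "\<tau> 1 \<le> \<tau> k" "\<tau> k \<le> \<tau> K" using that by (auto simp: mono_on_def)
    with assms(2) show ?thesis by simp
  qed
  interpret hamiltonian_delay_system K \<tau> H
    using range range[of K] assms(1,4,5) by unfold_locales auto
  show ?thesis
    unfolding twisted_form_def[symmetric]
  proof (rule twisted_form_span)
    show "\<phi> \<in> fun_space.span ((\<lambda>j. (Rop_inv K \<tau> H \<sigma> ^^ j) \<phi>\<^sub>1) ` {..<m})"
      "\<psi> \<in> fun_space.span ((\<lambda>j. (Rop_inv K \<tau> H \<sigma> ^^ j) \<phi>\<^sub>1) ` {..<m})"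
      using assms(10,11) by (simp_all add: krylov_def)
  qed (use assms(6,8) in \<open>auto intro: Rop_inv_funpow_in_X twisted_form_iterates\<close>)
qed

end
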